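(* Let $\beta_1,\beta_2>1$ with $\beta_1\neq\beta_2$ be such that \[ \left|\frac{\beta_2^8-\beta_1^8}{\beta_2^7-\beta_1^7} \right| + \left|\frac{\beta_2^7 \beta_1^7 (\beta_2-\beta_1)}{\beta_2^7-\beta_1^7} \right| \leq 2. \] Then $(\beta_1,\beta_2)\in\mathcal Z$, i.e. $(0,0)$ is an interior point of $A_{\beta_1,\beta_2}$.
   Context: For $\beta_1,\beta_2>1$ and $i\in\{-1,1\}$ let $T_i:\mathbb R^2\to\mathbb R^2$, $T_i(x,y)=\left(\frac{x+i}{\beta_1},\frac{y+i}{\beta_2}\right)$. Let $A=A_{\beta_1,\beta_2}$ be the attractor of $\{T_{-1},T_1\}$, i.e. the unique non-empty compact set with $A=T_1(A)\cup T_{-1}(A)$. Define $\mathcal Z=\{(\beta_1,\beta_2): (0,0)\in A^o\}$, where $A^o$ is the interior of $A$ in $\mathbb R^2$. *)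

theory Defs
  imports "HOL-Analysis.Analysis"
begin

definition ifs_map :: "real \<Rightarrow> real \<Rightarrow> real \<Rightarrow> real \<times> real \<Rightarrow> real \<times> real" where
  "ifs_map \<beta>1 \<beta>2 i = (\<lambda>(x, y). ((x + i) / \<beta>1, (y + i) / \<beta>2))"

definition is_attractor :: "real \<Rightarrow> real \<Rightarrow> (real \<times> real) set \<Rightarrow> bool" where
  "is_attractor \<beta>1 \<beta>2 A \<longleftrightarrow>
     compact A \<and> A \<noteq> {} \<and> A = ifs_map \<beta>1 \<beta>2 1 ` A \<union> ifs_map \<beta>1 \<beta>2 (-1) ` A"

text \<open>The description is proper only for \<open>\<beta>1, \<beta>2 > 1\<close>; see \<open>ex1_attractor\<close> below.\<close>

definition attractor :: "real \<Rightarrow> real \<Rightarrow> (real \<times> real) set" where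
  "attractor \<beta>1 \<beta>2 = (THE A. is_attractor \<beta>1 \<beta>2 A)"

definition Z_set :: "(real \<times> real) set" where
  "Z_set = {(\<beta>1, \<beta>2). \<beta>1 > 1 \<and> \<beta>2 > 1 \<and> (0, 0) \<in> interior (attractor \<beta>1 \<beta>2)}"

lemma continuous_on_ifs_map: "continuous_on S (ifs_map \<beta>1 \<beta>2 i)"
  unfolding ifs_map_def case_prod_unfold divide_inverse
  by (intro continuous_intros)

lemma inj_ifs_map: "\<beta>1 > 1 \<Longrightarrow> \<beta>2 > 1 \<Longrightarrow> inj (ifs_map \<beta>1 \<beta>2 i)"
  by (auto simp: inj_def ifs_map_def)

lemma dist_ifs_map:
  assumes "\<beta>1 > 1" "\<beta>2 > 1"
  shows "dist (ifs_map \<beta>1 \<beta>2 i p) (ifs_map \<beta>1 \<beta>2 i q) \<le> dist p q / min \<beta>1 \<beta>2"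
proof -
  obtain x y u v where pq: "p = (x, y)" "q = (u, v)" by (cases p, cases q) auto
  define m where "m = min \<beta>1 \<beta>2"
  have m: "m > 0" "m \<le> \<beta>1" "m \<le> \<beta>2" using assms by (auto simp: m_def)
  have shrink: "(dist ((a + i) / \<beta>) ((b + i) / \<beta>))\<^sup>2 \<le> (dist a b / m)\<^sup>2"
    if "m \<le> \<beta>" for a b \<beta> :: real
  proof (rule power_mono)
    have "dist ((a + i) / \<beta>) ((b + i) / \<beta>) = dist a b / \<beta>"
      using that m by (simp add: dist_real_def diff_divide_distrib[symmetric] abs_divide)
    also have "\<dots> \<le> dist a b / m" using that m by (intro divide_left_mono) auto
    finally show "dist ((a + i) / \<beta>) ((b + i) / \<beta>) \<le> dist a b / m" .
  qed simp
  have "dist (ifs_map \<beta>1 \<beta>2 i p) (ifs_map \<beta>1 \<beta>2 i q)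
      \<le> sqrt ((dist x u / m)\<^sup>2 + (dist y v / m)\<^sup>2)"
    using shrink[OF m(2), of x u] shrink[OF m(3), of y v]
    by (simp add: pq ifs_map_def dist_Pair_Pair add_mono)
  also have "\<dots> = sqrt (((dist x u)\<^sup>2 + (dist y v)\<^sup>2) / m\<^sup>2)"
    by (simp add: power_divide add_divide_distrib)
  also have "\<dots> = dist p q / m"
    using m by (simp add: pq dist_Pair_Pair real_sqrt_divide)
  finally show ?thesis by (simp add: m_def)
qed

lemma attractor_subset:
  assumes \<beta>: "\<beta>1 > 1" "\<beta>2 > 1"
    and A: "is_attractor \<beta>1 \<beta>2 A" and B: "is_attractor \<beta>1 \<beta>2 B"
  shows "A \<subseteq> B"
proof -
  have Ac: "compact A" "A \<noteq> {}" and Bc: "closed B" "B \<noteq> {}"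
    using A B by (auto simp: is_attractor_def compact_imp_closed)
  have m: "min \<beta>1 \<beta>2 > 1" using \<beta> by auto
  obtain a where a: "a \<in> A" and amax: "\<And>y. y \<in> A \<Longrightarrow> infdist y B \<le> infdist a B"
    using continuous_attains_sup[OF Ac, of "\<lambda>x. infdist x B"]
    using continuous_on_infdist[OF continuous_on_id] by blast
  have "A = ifs_map \<beta>1 \<beta>2 1 ` A \<union> ifs_map \<beta>1 \<beta>2 (-1) ` A"
    using A by (simp add: is_attractor_def)
  with a obtain i a' where i: "i \<in> {1, -1}" and a': "a' \<in> A" "a = ifs_map \<beta>1 \<beta>2 i a'"
    by blast
  obtain b where b: "b \<in> B" "infdist a' B = dist a' b"
    using infdist_attains_inf[OF Bc] by blast
  have "B = ifs_map \<beta>1 \<beta>2 1 ` B \<union> ifs_map \<beta>1 \<beta>2 (-1) ` B"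
    using B by (simp add: is_attractor_def)
  with b i have "ifs_map \<beta>1 \<beta>2 i b \<in> B" by blast
  then have "infdist a B \<le> dist a (ifs_map \<beta>1 \<beta>2 i b)" by (rule infdist_le)
  also have "\<dots> \<le> infdist a' B / min \<beta>1 \<beta>2"
    using dist_ifs_map[OF \<beta>] by (simp add: a' b)
  also have "\<dots> \<le> infdist a B / min \<beta>1 \<beta>2"
    using amax[OF a'(1)] m by (intro divide_right_mono) auto
  finally have "infdist a B * min \<beta>1 \<beta>2 \<le> infdist a B"
    using m by (simp only: pos_le_divide_eq)
  then have "infdist a B * (min \<beta>1 \<beta>2 - 1) \<le> 0" by (simp only: right_diff_distrib)
  then have "infdist a B \<le> 0" using m by (simp only: mult_le_0_iff) linarith
  then have "infdist y B = 0" if "y \<in> A" for y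
    using amax[OF that] infdist_nonneg[of y B] by linarith
  then show ?thesis using in_closed_iff_infdist_zero[OF Bc] by blast
qed

lemma attractor_exists:
  assumes \<beta>: "\<beta>1 > 1" "\<beta>2 > 1"
  shows "\<exists>A. is_attractor \<beta>1 \<beta>2 A"
proof -
  define F where "F S = ifs_map \<beta>1 \<beta>2 1 ` S \<union> ifs_map \<beta>1 \<beta>2 (-1) ` S" for S
  define R1 R2 where "R1 = 1 / (\<beta>1 - 1)" and "R2 = 1 / (\<beta>2 - 1)"
  define K where "K n = (F ^^ n) ({-R1..R1} \<times> {-R2..R2})" for n
  have KS: "K (Suc n) = F (K n)" for n by (simp add: K_def)
  have mono: "F S \<subseteq> F S'" if "S \<subseteq> S'" for S S' using that by (auto simp: F_def)
  have R: "R1 \<ge> 0" "R2 \<ge> 0" using \<beta> by (auto simp: R1_def R2_def)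
  have box: "\<bar>(x + i) / \<beta>\<bar> \<le> 1 / (\<beta> - 1)"
    if "\<beta> > 1" "\<bar>x\<bar> \<le> 1 / (\<beta> - 1)" "\<bar>i\<bar> = 1" for x i \<beta> :: real
  proof -
    have "\<bar>x + i\<bar> \<le> 1 / (\<beta> - 1) + 1" using that by linarith
    also have "\<dots> = 1 / (\<beta> - 1) * \<beta>" using that by (simp add: field_simps)
    finally show ?thesis using that by (simp add: abs_divide pos_divide_le_eq)
  qed
  have K1: "K (Suc 0) \<subseteq> K 0"
  proof
    fix q assume "q \<in> K (Suc 0)"
    then obtain i p where i: "i = 1 \<or> i = -1" and p: "p \<in> K 0" and qp: "q = ifs_map \<beta>1 \<beta>2 i p"
      unfolding KS F_def by blast
    from i have i: "\<bar>i\<bar> = 1" by auto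
    obtain x y where "p = (x, y)" by (cases p)
    with p qp have xy: "(x, y) \<in> K 0" and q: "q = ifs_map \<beta>1 \<beta>2 i (x, y)" by simp_all
    have "\<bar>x\<bar> \<le> R1" "\<bar>y\<bar> \<le> R2" using xy by (auto simp: K_def)
    then have "\<bar>(x + i) / \<beta>1\<bar> \<le> R1" "\<bar>(y + i) / \<beta>2\<bar> \<le> R2"
      using box[OF \<beta>(1) _ i] box[OF \<beta>(2) _ i] by (auto simp: R1_def R2_def)
    then have "- R1 \<le> (x + i) / \<beta>1" "(x + i) / \<beta>1 \<le> R1" "- R2 \<le> (y + i) / \<beta>2" "(y + i) / \<beta>2 \<le> R2"
      by linarith+
    then show "q \<in> K 0" unfolding q K_def by (simp add: ifs_map_def)
  qed
  have dec: "K (Suc n) \<subseteq> K n" for n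
  proof (induction n)
    case 0
    show ?case by (rule K1)
  next
    case (Suc n)
    then have "F (K (Suc n)) \<subseteq> F (K n)" by (rule mono)
    then show ?case by (simp only: KS)
  qed
  have decm: "K n \<subseteq> K m" if "m \<le> n" for m n
    using lift_Suc_antimono_le[of K, OF dec that] .
  have comp: "compact (K n)" for n
  proof (induction n)
    case 0
    show ?case by (simp add: K_def compact_Times)
  next
    case (Suc n)
    then show ?case unfolding KS F_def
      by (intro compact_Un compact_continuous_image continuous_on_ifs_map)
  qed
  have ne: "K n \<noteq> {}" for n
  proof (induction n)
    case 0
    show ?case using R by (simp add: K_def)
  next
    case (Suc n)
    then show ?case by (simp add: KS F_def)
  qed
  let ?A = "\<Inter>(range K)"
  have "compact ?A" using comp by (intro compact_Inter) auto
  moreover have "?A \<noteq> {}" using compact_nest[OF comp ne decm] by simp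
  moreover have "?A = F ?A"
  proof
    show "F ?A \<subseteq> ?A"
    proof -
      have "F ?A \<subseteq> K n" for n
      proof -
        have "F ?A \<subseteq> F (K n)" by (rule mono) auto
        also have "\<dots> \<subseteq> K n" using dec[of n] by (simp only: KS)
        finally show ?thesis .
      qed
      then show ?thesis by blast
    qed
    show "?A \<subseteq> F ?A"
    proof
      fix q assume q: "q \<in> ?A"
      show "q \<in> F ?A"
      proof (rule ccontr)
        assume nq: "q \<notin> F ?A"
        have ex: "\<exists>n. q \<notin> ifs_map \<beta>1 \<beta>2 i ` K n" if "i \<in> {1, -1}" for i
        proof (rule ccontr)
          assume "\<not> ?thesis"
          then have "q \<in> (\<Inter>n. ifs_map \<beta>1 \<beta>2 i ` K n)" by blast
          then have "q \<in> ifs_map \<beta>1 \<beta>2 i ` ?A"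
            using image_INT[OF inj_ifs_map[OF \<beta>], of UNIV K 0 i] by simp
          then show False using nq that unfolding F_def by blast
        qed
        obtain n where n: "q \<notin> ifs_map \<beta>1 \<beta>2 1 ` K n" using ex[of 1] by auto
        obtain n' where n': "q \<notin> ifs_map \<beta>1 \<beta>2 (-1) ` K n'" using ex[of "-1"] by auto
        have "q \<notin> F (K (max n n'))"
          using n n' image_mono[OF decm[of n "max n n'"]] image_mono[OF decm[of n' "max n n'"]]
          unfolding F_def by (metis UnE max.cobounded1 max.cobounded2 subsetD)
        moreover have "q \<in> K (Suc (max n n'))" using q by blast
        ultimately show False by (simp only: KS)
      qed
    qed
  qed
  ultimately show ?thesis unfolding is_attractor_def F_def by blast
qed

lemma ex1_attractor:
  assumes "\<beta>1 > 1" "\<beta>2 > 1"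
  shows "\<exists>!A. is_attractor \<beta>1 \<beta>2 A"
  using attractor_exists[OF assms] attractor_subset[OF assms] by (blast intro: subset_antisym)

lemma is_attractor_attractor:
  assumes "\<beta>1 > 1" "\<beta>2 > 1"
  shows "is_attractor \<beta>1 \<beta>2 (attractor \<beta>1 \<beta>2)"
  unfolding attractor_def by (rule theI') (rule ex1_attractor[OF assms])

end

theory Submission
  imports Defs
begin

text \<open>
  Both \<open>\<beta>1\<close> and \<open>\<beta>2\<close> are roots of the trinomial \<open>x ^ 8 = a * x ^ 7 + c\<close>, where \<open>a\<close> and \<open>-c\<close>
  are the two quotients in the hypothesis; the hypothesis therefore reads \<open>\<bar>a\<bar> + \<bar>c\<bar> \<le> 2\<close>.
  The result holds for every pair of distinct common roots \<open>\<beta>1, \<beta>2 > 1\<close> of a monic polynomial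
  \<open>x ^ n = p\<^sub>0 + p\<^sub>1 * x + \<dots> + p\<^sub>m * x ^ m\<close>, \<open>n = m + 1\<close>, with \<open>\<bar>p\<^sub>0\<bar> + \<dots> + \<bar>p\<^sub>m\<bar> \<le> 2\<close>
  (lemma \<open>common_roots_in_Z_set\<close>).

  The idea is to run the recurrence of this polynomial with a correction. On a state
  \<open>v \<in> [-1, 1] ^ n\<close> the recurrence drops the oldest entry \<open>v\<^sub>0\<close> and appends
  \<open>s = p\<^sub>0 * v\<^sub>0 + \<dots> + p\<^sub>m * v\<^sub>m\<close>. Since \<open>\<bar>s\<bar> \<le> 2\<close>, one of \<open>s - 1\<close> and \<open>s + 1\<close> lies in
  \<open>[-1, 1]\<close>, so after appending \<open>s - i\<close> for a suitable digit \<open>i = 1\<close> or \<open>i = -1\<close> the new state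
  is again in the cube. The uncorrected step is the companion matrix of the polynomial. If \<open>L\<^sub>\<beta>\<close>
  is its left eigenvector for the root \<open>\<beta>\<close>, normalised to have last entry 1, then \<open>L\<^sub>\<beta>\<close> takes
  the value \<open>\<beta> * L\<^sub>\<beta> v - i\<close> on the new state. So the point \<open>(L\<^sub>\<beta>\<^sub>1 v, L\<^sub>\<beta>\<^sub>2 v)\<close> is the
  image under \<open>T\<^sub>i\<close> of the corresponding point for the new state: the projection \<open>B\<close> of the cube
  by \<open>(L\<^sub>\<beta>\<^sub>1, L\<^sub>\<beta>\<^sub>2)\<close> satisfies \<open>B \<subseteq> T\<^sub>1(B) \<union> T\<^sub>-\<^sub>1(B)\<close>.

  A bounded set with this property lies in the attractor (lemma
  \<open>bounded_self_covered_subset_attractor\<close>), because points of \<open>B\<close> can be pulled back inside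
  \<open>B\<close> arbitrarily often while the maps contract distances. Finally, eigenvectors for the
  distinct eigenvalues \<open>\<beta>1, \<beta>2\<close> are independent, so \<open>B\<close> is the image of a cube centred at the
  origin under a linear map onto the plane, and contains a neighbourhood of \<open>(0, 0)\<close>.
\<close>

section \<open>Sets covered by their own images\<close>

text \<open>
  The supremum \<open>d\<close> of the distances from points of \<open>B\<close> to the attractor \<open>A\<close> is finite. A point
  of \<open>B\<close> is the image of another point of \<open>B\<close> under a map that contracts by \<open>min \<beta>1 \<beta>2\<close> and
  sends \<open>A\<close> into itself, whence \<open>d \<le> d / min \<beta>1 \<beta>2\<close> and \<open>d = 0\<close>.
\<close>

lemma bounded_self_covered_subset_attractor:
  assumes \<beta>: "\<beta>1 > 1" "\<beta>2 > 1"
    and A: "is_attractor \<beta>1 \<beta>2 A"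
    and B: "bounded B" "B \<subseteq> ifs_map \<beta>1 \<beta>2 1 ` B \<union> ifs_map \<beta>1 \<beta>2 (-1) ` B"
  shows "B \<subseteq> A"
proof (cases "B = {}")
  case False
  define m where "m = min \<beta>1 \<beta>2"
  have m: "m > 1" using \<beta> by (simp add: m_def)
  have Ac: "closed A" "A \<noteq> {}"
    and AT: "A = ifs_map \<beta>1 \<beta>2 1 ` A \<union> ifs_map \<beta>1 \<beta>2 (-1) ` A"
    using A by (auto simp: is_attractor_def compact_imp_closed)
  define d where "d = (SUP p\<in>B. infdist p A)"
  have bdd: "bdd_above ((\<lambda>p. infdist p A) ` B)"
  proof -
    obtain a where a: "a \<in> A" using Ac(2) by blast
    obtain e where "\<And>p. p \<in> B \<Longrightarrow> dist a p \<le> e"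
      using B(1) unfolding bounded_any_center[of B a] by blast
    then have "infdist p A \<le> e" if "p \<in> B" for p
      using infdist_le[OF a, of p] that by (fastforce simp: dist_commute)
    then show ?thesis by (rule bdd_aboveI2)
  qed
  have le_d: "infdist p A \<le> d" if "p \<in> B" for p
    unfolding d_def using that by (rule cSUP_upper[OF _ bdd])
  have "infdist p A \<le> d / m" if p: "p \<in> B" for p
  proof -
    obtain i q where i: "i \<in> {1, -1}" and q: "q \<in> B" "p = ifs_map \<beta>1 \<beta>2 i q"
      using p B(2) by blast
    obtain b where b: "b \<in> A" "infdist q A = dist q b"
      using infdist_attains_inf[OF Ac] by blast
    have "ifs_map \<beta>1 \<beta>2 i b \<in> A" using AT b(1) i by blast
    then have "infdist p A \<le> dist p (ifs_map \<beta>1 \<beta>2 i b)" by (rule infdist_le)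
    also have "\<dots> \<le> infdist q A / m"
      using dist_ifs_map[OF \<beta>] by (simp add: q b m_def)
    also have "\<dots> \<le> d / m" using le_d[OF q(1)] m by (intro divide_right_mono) auto
    finally show ?thesis .
  qed
  then have "d \<le> d / m"
    unfolding d_def[symmetric] by (subst d_def) (rule cSUP_least[OF False])
  then have "d * (m - 1) \<le> 0" using m by (simp add: field_simps)
  then have "d \<le> 0" using m by (simp add: mult_le_0_iff)
  then have "infdist p A = 0" if "p \<in> B" for p
    using le_d[OF that] infdist_nonneg[of p A] by linarith
  then show ?thesis using in_closed_iff_infdist_zero[OF Ac] by blast
qed simp

section \<open>Left eigenvectors of a companion matrix\<close>

text \<open>
  The entries are the solution of \<open>x * h\<^sub>0 = p\<^sub>0\<close> and \<open>x * h\<^sub>i = h\<^sub>i\<^sub>-\<^sub>1 + p\<^sub>i\<close>, the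
  left eigenvector equation for the eigenvalue \<open>x\<close> once the last entry is 1.
\<close>

definition companion_eigvec :: "(nat \<Rightarrow> real) \<Rightarrow> real \<Rightarrow> nat \<Rightarrow> real" where
  "companion_eigvec p x i = (\<Sum>j\<le>i. p j * x ^ j) / x ^ Suc i"

lemma companion_eigvec_0: "x \<noteq> 0 \<Longrightarrow> x * companion_eigvec p x 0 = p 0"
  by (simp add: companion_eigvec_def)

lemma companion_eigvec_Suc:
  "x \<noteq> 0 \<Longrightarrow> x * companion_eigvec p x (Suc i) = companion_eigvec p x i + p (Suc i)"
  by (simp add: companion_eigvec_def field_simps)

lemma companion_eigvec_last:
  assumes "x \<noteq> 0" "x ^ Suc m = (\<Sum>j\<le>m. p j * x ^ j)"
  shows "companion_eigvec p x m = 1"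
  using assms(1) by (simp add: companion_eigvec_def del: power_Suc flip: assms(2))

definition companion_form :: "(nat \<Rightarrow> real) \<Rightarrow> nat \<Rightarrow> real \<Rightarrow> (nat \<Rightarrow> real) \<Rightarrow> real" where
  "companion_form p m x v = (\<Sum>i\<le>m. companion_eigvec p x i * v i)"

definition corrected_shift :: "(nat \<Rightarrow> real) \<Rightarrow> nat \<Rightarrow> real \<Rightarrow> (nat \<Rightarrow> real) \<Rightarrow> nat \<Rightarrow> real" where
  "corrected_shift p m i v k = (if k < m then v (Suc k) else (\<Sum>j\<le>m. p j * v j) - i)"

text \<open>
  For \<open>i = 0\<close> this is the left eigenvector property; the correction enters with the last entry
  of the eigenvector, which is 1 exactly because \<open>x\<close> is a root.
\<close>

lemma companion_form_corrected_shift: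
  assumes x: "x \<noteq> 0" "x ^ Suc m = (\<Sum>j\<le>m. p j * x ^ j)"
  shows "companion_form p m x (corrected_shift p m i v) = x * companion_form p m x v - i"
proof -
  let ?h = "companion_eigvec p x"
  have "x * companion_form p m x v = (\<Sum>k\<le>m. (x * ?h k) * v k)"
    by (simp add: companion_form_def sum_distrib_left mult.assoc)
  also have "\<dots> = (\<Sum>k<m. ?h k * v (Suc k)) + (\<Sum>k\<le>m. p k * v k)"
    using x(1)
    by (simp add: sum.atMost_shift companion_eigvec_0 companion_eigvec_Suc
        distrib_right sum.distrib)
  also have "\<dots> = companion_form p m x (corrected_shift p m i v) + i"
    using companion_eigvec_last[OF x]
    by (simp add: companion_form_def corrected_shift_def flip: lessThan_Suc_atMost)
  finally show ?thesis by simp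
qed

text \<open>
  The bound 2 on the coefficients puts the next entry of the recurrence into \<open>[-2, 2]\<close>;
  subtracting its sign brings it back to \<open>[-1, 1]\<close>.
\<close>

lemma corrected_shift_stays_in_cube:
  assumes p: "(\<Sum>j\<le>m. \<bar>p j\<bar>) \<le> 2" and v: "\<And>k. \<bar>v k\<bar> \<le> 1"
  obtains i where "i \<in> {1, -1 :: real}" "\<And>k. \<bar>corrected_shift p m i v k\<bar> \<le> 1"
proof -
  define s where "s = (\<Sum>j\<le>m. p j * v j)"
  have "\<bar>s\<bar> \<le> (\<Sum>j\<le>m. \<bar>p j\<bar>)"
    unfolding s_def using v
    by (intro order.trans[OF sum_abs] sum_mono) (auto simp: abs_mult intro!: mult_left_le)
  then have s: "\<bar>s\<bar> \<le> 2" using p by simp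
  define i :: real where "i = (if s \<ge> 0 then 1 else -1)"
  have "\<bar>s - i\<bar> \<le> 1" using s by (auto simp: i_def)
  then have "\<bar>corrected_shift p m i v k\<bar> \<le> 1" for k
    using v by (simp add: corrected_shift_def s_def)
  moreover have "i \<in> {1, -1}" by (simp add: i_def)
  ultimately show ?thesis using that by blast
qed

lemma abs_companion_form_le:
  assumes "\<And>k. \<bar>v k\<bar> \<le> 1"
  shows "\<bar>companion_form p m x v\<bar> \<le> (\<Sum>i\<le>m. \<bar>companion_eigvec p x i\<bar>)"
  unfolding companion_form_def using assms
  by (intro order.trans[OF sum_abs] sum_mono) (auto simp: abs_mult intro!: mult_left_le)

section \<open>Projections of the cube\<close>

definition cube_projection :: "(nat \<Rightarrow> real) \<Rightarrow> nat \<Rightarrow> real \<Rightarrow> real \<Rightarrow> (real \<times> real) set" where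
  "cube_projection p m x y =
     (\<lambda>v. (companion_form p m x v, companion_form p m y v)) ` {v. \<forall>k. \<bar>v k\<bar> \<le> 1}"

lemma bounded_cube_projection: "bounded (cube_projection p m x y)"
proof -
  have "cube_projection p m x y \<subseteq>
      cball 0 (\<Sum>i\<le>m. \<bar>companion_eigvec p x i\<bar>) \<times> cball 0 (\<Sum>i\<le>m. \<bar>companion_eigvec p y i\<bar>)"
    using abs_companion_form_le by (auto simp: cube_projection_def)
  then show ?thesis by (rule bounded_subset[rotated]) (intro bounded_Times bounded_cball)
qed

lemma cube_projection_self_covered:
  assumes nz: "x \<noteq> 0" "y \<noteq> 0" and p: "(\<Sum>j\<le>m. \<bar>p j\<bar>) \<le> 2"
    and roots: "x ^ Suc m = (\<Sum>j\<le>m. p j * x ^ j)" "y ^ Suc m = (\<Sum>j\<le>m. p j * y ^ j)"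
  shows "cube_projection p m x y \<subseteq>
    ifs_map x y 1 ` cube_projection p m x y \<union> ifs_map x y (-1) ` cube_projection p m x y"
proof
  fix q assume "q \<in> cube_projection p m x y"
  then obtain v where v: "\<And>k. \<bar>v k\<bar> \<le> 1"
    and q: "q = (companion_form p m x v, companion_form p m y v)"
    by (auto simp: cube_projection_def)
  obtain i where i: "i \<in> {1, -1}" and w: "\<And>k. \<bar>corrected_shift p m i v k\<bar> \<le> 1"
    using corrected_shift_stays_in_cube[OF p, of v] v by blast
  let ?w = "corrected_shift p m i v"
  have "q = ifs_map x y i (companion_form p m x ?w, companion_form p m y ?w)"
    using nz by (simp add: q ifs_map_def companion_form_corrected_shift[OF nz(1) roots(1)]
        companion_form_corrected_shift[OF nz(2) roots(2)])
  moreover have "(companion_form p m x ?w, companion_form p m y ?w) \<in> cube_projection p m x y"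
    using w by (auto simp: cube_projection_def)
  ultimately show "q \<in> ifs_map x y 1 ` cube_projection p m x y
      \<union> ifs_map x y (-1) ` cube_projection p m x y"
    using i by blast
qed

text \<open>
  The last two columns of the matrix with rows \<open>L\<^sub>x\<close> and \<open>L\<^sub>y\<close> already span the plane: they
  are \<open>(1, 1)\<close> and \<open>(x - p\<^sub>m, y - p\<^sub>m)\<close>. So small points are reached with states supported on
  these two coordinates.
\<close>

lemma zero_interior_cube_projection:
  assumes nz: "x \<noteq> 0" "y \<noteq> 0" and xy: "x \<noteq> y"
    and roots: "x ^ Suc m = (\<Sum>j\<le>m. p j * x ^ j)" "y ^ Suc m = (\<Sum>j\<le>m. p j * y ^ j)"
  shows "(0, 0) \<in> interior (cube_projection p m x y)"
proof -
  \<comment> \<open>a polynomial of degree 1 does not have two roots\<close>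
  have "m \<noteq> 0"
  proof
    assume "m = 0"
    then show False using roots xy by simp
  qed
  then obtain l where m: "m = Suc l" using not0_implies_Suc by blast
  have form: "companion_form p m z ((\<lambda>_. 0)(m := s, l := t)) = s + t * (z - p m)"
    if "z \<noteq> 0" "z ^ Suc m = (\<Sum>j\<le>m. p j * z ^ j)" for z s t
  proof -
    have "companion_eigvec p z l = z - p m"
      using companion_eigvec_Suc[OF that(1), of p l] companion_eigvec_last[OF that] by (simp add: m)
    moreover have "(\<Sum>i<l. companion_eigvec p z i * ((\<lambda>_. 0)(m := s, l := t)) i) = 0"
      by (rule sum.neutral) (simp add: m)
    ultimately show ?thesis
      using companion_eigvec_last[OF that]
      by (simp add: companion_form_def m flip: lessThan_Suc_atMost)
  qed
  \<comment> \<open>the solution of \<open>s + t * (x - p m) = fst q\<close> and \<open>s + t * (y - p m) = snd q\<close>\<close>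
  define t where "t q = (fst q - snd q) / (x - y)" for q :: "real \<times> real"
  define s where "s q = fst q - t q * (x - p m)" for q
  have solves: "s q + t q * (x - p m) = fst q" "s q + t q * (y - p m) = snd q" for q
  proof -
    show "s q + t q * (x - p m) = fst q" by (simp add: s_def)
    have "t q * (x - y) = fst q - snd q" using xy by (simp add: t_def)
    then show "s q + t q * (y - p m) = snd q" by (simp add: s_def algebra_simps)
  qed
  let ?U = "{q. \<bar>s q\<bar> < 1} \<inter> {q. \<bar>t q\<bar> < 1}"
  have "open ?U"
    unfolding s_def t_def using xy by (intro open_Int open_Collect_less continuous_intros) auto
  moreover have "(0, 0) \<in> ?U" by (simp add: s_def t_def)
  moreover have "?U \<subseteq> cube_projection p m x y"
  proof
    fix q assume q: "q \<in> ?U"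
    let ?v = "(\<lambda>_. 0)(m := s q, l := t q)"
    have "q = (companion_form p m x ?v, companion_form p m y ?v)"
      using nz roots by (simp add: form solves)
    moreover have "\<forall>k. \<bar>?v k\<bar> \<le> 1" using q by auto
    ultimately show "q \<in> cube_projection p m x y" unfolding cube_projection_def by blast
  qed
  ultimately show ?thesis by (intro interiorI)
qed

lemma common_roots_in_Z_set:
  assumes \<beta>: "\<beta>1 > 1" "\<beta>2 > 1" "\<beta>1 \<noteq> \<beta>2" and p: "(\<Sum>j\<le>m. \<bar>p j\<bar>) \<le> 2"
    and roots: "\<beta>1 ^ Suc m = (\<Sum>j\<le>m. p j * \<beta>1 ^ j)" "\<beta>2 ^ Suc m = (\<Sum>j\<le>m. p j * \<beta>2 ^ j)"
  shows "(\<beta>1, \<beta>2) \<in> Z_set"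
proof -
  have nz: "\<beta>1 \<noteq> 0" "\<beta>2 \<noteq> 0" using \<beta> by auto
  have "cube_projection p m \<beta>1 \<beta>2 \<subseteq> attractor \<beta>1 \<beta>2"
    using \<beta>(1,2) is_attractor_attractor[OF \<beta>(1,2)] bounded_cube_projection
      cube_projection_self_covered[OF nz p roots]
    by (rule bounded_self_covered_subset_attractor)
  then have "(0, 0) \<in> interior (attractor \<beta>1 \<beta>2)"
    using zero_interior_cube_projection[OF nz \<beta>(3) roots] interior_mono by blast
  then show ?thesis using \<beta> by (simp add: Z_set_def)
qed

section \<open>The trinomial\<close>

theorem theorem1p2:
  fixes \<beta>1 \<beta>2 :: real
  assumes "\<beta>1 > 1" and "\<beta>2 > 1" and "\<beta>1 \<noteq> \<beta>2"
    and "\<bar>(\<beta>2 ^ 8 - \<beta>1 ^ 8) / (\<beta>2 ^ 7 - \<beta>1 ^ 7)\<bar>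
         + \<bar>(\<beta>2 ^ 7 * \<beta>1 ^ 7 * (\<beta>2 - \<beta>1)) / (\<beta>2 ^ 7 - \<beta>1 ^ 7)\<bar> \<le> 2"
  shows "(\<beta>1, \<beta>2) \<in> Z_set"
proof -
  define D where "D = \<beta>2 ^ 7 - \<beta>1 ^ 7"
  have D: "D \<noteq> 0"
    using assms(1-3) power_eq_iff_eq_base[of 7 \<beta>2 \<beta>1] by (simp add: D_def)
  define a where "a = (\<beta>2 ^ 8 - \<beta>1 ^ 8) / D"
  define c where "c = - (\<beta>2 ^ 7 * \<beta>1 ^ 7 * (\<beta>2 - \<beta>1)) / D"
  define p :: "nat \<Rightarrow> real" where "p = (\<lambda>_. 0)(0 := c, 7 := a)"
  have sum_p: "(\<Sum>j\<le>7. p j * z ^ j) = c + a * z ^ 7" for z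
    by (simp add: p_def atMost_nat_numeral)
  have pow8: "z ^ 8 = z * z ^ 7" for z :: real
    by (simp flip: power_Suc)
  \<comment> \<open>Cramer's rule: \<open>a\<close> and \<open>c\<close> solve the linear system saying that both are roots\<close>
  have "c + a * \<beta>1 ^ 7 = \<beta>1 ^ 8" "c + a * \<beta>2 ^ 7 = \<beta>2 ^ 8"
    using D unfolding a_def c_def pow8 by (simp_all add: field_simps) (simp_all add: D_def algebra_simps)
  then have roots: "\<beta>1 ^ Suc 7 = (\<Sum>j\<le>7. p j * \<beta>1 ^ j)" "\<beta>2 ^ Suc 7 = (\<Sum>j\<le>7. p j * \<beta>2 ^ j)"
    by (simp_all add: sum_p)
  have "(\<Sum>j\<le>7. \<bar>p j\<bar>) = \<bar>c\<bar> + \<bar>a\<bar>" by (simp add: p_def atMost_nat_numeral)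
  also have "\<dots> \<le> 2" using assms(4) by (simp add: a_def c_def D_def)
  finally show ?thesis
    using common_roots_in_Z_set[OF assms(1-3) _ roots] by blast
qed

end
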